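(* Let $K$ be an infinite compact Hausdorff connected space, and let $C(K)$ be the Banach space of real continuous functions on $K$ with the supremum norm. (a) If $K$ is homeomorphic to a finite union of segments of $\mathbb{R}$, then $C(K)$ is light. (b) If $K$ contains an $n$-dimensional region for some $n\ge 2$, then $C(K)$ is not light.
   Context: An $n$-dimensional region of $K$ is a (non-empty) open subset of $K$ homeomorphic to an open subset of $\mathbb{R}^n$. A Banach space $X$ is light if its group $\mathrm{Isom}(X)$ of surjective linear isometries is light, i.e. the Weak Operator Topology (generated by the maps $T\mapsto x^*(Tx)$, $x\in X$, $x^*\in X^*$) and the Strong Operator Topology (pointwise norm convergence on $X$) coincide on $\mathrm{Isom}(X)$. *)

theory Defs
  imports "HOL-Analysis.Analysis"
begin

text \<open>
  The dual of \<open>'a\<close> is \<open>'a \<Rightarrow>\<^sub>L real\<close>.  This is the initial topology on the bounded operators for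
  the maps \<open>T \<mapsto> f (T x)\<close>; its companion \<open>strong_operator_topology\<close> is in
  HOL-Analysis.
\<close>
definition weak_operator_topology ::
    "('a::real_normed_vector \<Rightarrow>\<^sub>L 'b::real_normed_vector) topology" where
  "weak_operator_topology = topology_generated_by
     {{T. blinfun_apply f (blinfun_apply T x) \<in> U} | (x :: 'a) (f :: 'b \<Rightarrow>\<^sub>L real) U. open U}"

text \<open>An isometric linear map is bounded, so it is no restriction to work inside \<open>'a \<Rightarrow>\<^sub>L 'a\<close>.\<close>
definition Isom :: "('a::real_normed_vector \<Rightarrow>\<^sub>L 'a) set" where
  "Isom = {T. surj (blinfun_apply T) \<and> (\<forall>x. norm (blinfun_apply T x) = norm x)}"

definition light_group :: "('a::real_normed_vector \<Rightarrow>\<^sub>L 'a) set \<Rightarrow> bool" where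
  "light_group G \<longleftrightarrow>
     subtopology weak_operator_topology G = subtopology strong_operator_topology G"

text \<open>
  Completeness is not used in the definition, and the sort is left at \<open>real_normed_vector\<close>
  because HOL-Analysis makes \<open>'k \<Rightarrow>\<^sub>C real\<close> an instance of class \<open>banach\<close> only for
  metric \<open>'k\<close>.
\<close>
definition light_space :: "'a::real_normed_vector itself \<Rightarrow> bool" where
  "light_space (_ :: 'a itself) \<longleftrightarrow> light_group (Isom :: ('a \<Rightarrow>\<^sub>L 'a) set)"

definition region :: "nat \<Rightarrow> 'a::topological_space set \<Rightarrow> bool" where
  "region n U \<longleftrightarrow> open U \<and> U \<noteq> {} \<and>
     (\<exists>V. openin (Euclidean_space n) V \<and>
          top_of_set U homeomorphic_space subtopology (Euclidean_space n) V)"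

text \<open>
  For a compact space \<open>K\<close>, given as a type \<open>'k\<close> with compact universe, the space \<open>C(K)\<close> is the
  library type \<open>'k \<Rightarrow>\<^sub>C real\<close> of bounded continuous functions with the supremum norm, since
  boundedness is then automatic.
\<close>
lemma bcontfun_compact_UNIV:
  assumes "compact (UNIV :: 'k::topological_space set)"
  shows "(bcontfun :: ('k \<Rightarrow> real) set) = {f. continuous_on UNIV f}"
proof -
  have "bounded (range f)" if "continuous_on UNIV f" for f :: "'k \<Rightarrow> real"
    using compact_continuous_image[OF that assms] by (rule compact_imp_bounded)
  then show ?thesis
    unfolding bcontfun_def by blast
qed

end

theory Submission
  imports Defs
begin

text \<open>
  (a) A connected finite union of segments is an interval \<open>{a..b}\<close>.  An isometry \<open>T\<close> of \<open>C({a..b})\<close>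
  has the form \<open>T f = c (f \<circ> p)\<close> with \<open>c = \<plusminus>1\<close> and a continuous injective, hence monotone,
  \<open>p\<close>: the function \<open>T 1\<close> has modulus one because \<open>1\<close> is extreme in the unit ball, so up to the
  sign \<open>c\<close> both \<open>T\<close> and its inverse are positive and \<open>T\<close> is a lattice homomorphism.
  Monotone maps that are close to \<open>p\<close> at the points of a fine net are uniformly close to \<open>p\<close>, so
  finitely many point evaluations, applied to the images of \<open>1\<close> and of the coordinate, control
  \<open>\<parallel>T f - T\<^sub>0 f\<parallel>\<close>.

  (b) In a cube inside the region, take homeomorphisms \<open>p\<^sub>k\<close> that are supported in disjoint
  parallel slabs and move some point by a fixed amount along the slab.  For every \<open>g\<close> the functions
  \<open>g \<circ> p\<^sub>k - g\<close> are bounded and have disjoint supports, so they tend weakly to \<open>0\<close>: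
  for a functional \<open>l\<close>, the partial sums of \<open>\<Sum>\<bar>l h\<^sub>k\<bar>\<close> are the values of \<open>l\<close> at
  \<open>\<Sum>\<plusminus>h\<^sub>k\<close>.  The isometries \<open>f \<mapsto> f \<circ> p\<^sub>k\<close> thus tend to the identity in the weak but not in the
  strong operator topology.
\<close>

section \<open>Isometries of spaces of continuous functions\<close>

lemma apply_Bcontfun:
  fixes f :: "'k::topological_space \<Rightarrow> real"
  assumes "compact (UNIV :: 'k set)" "continuous_on UNIV f"
  shows "apply_bcontfun (Bcontfun f) = f"
  using assms by (intro Bcontfun_inverse) (simp add: bcontfun_compact_UNIV)

lemma Isom_surjE:
  assumes "T \<in> Isom"
  obtains f where "blinfun_apply T f = g"
  using assms unfolding Isom_def by (metis (mono_tags, lifting) mem_Collect_eq surjD)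

lemma Isom_norm: "T \<in> Isom \<Longrightarrow> norm (blinfun_apply T f) = norm f"
  by (simp add: Isom_def)

lemma Isom_scaleR:
  assumes "T \<in> Isom" "\<bar>c\<bar> = 1"
  shows "c *\<^sub>R T \<in> Isom"
proof -
  have "\<exists>f. blinfun_apply (c *\<^sub>R T) f = g" for g
  proof -
    obtain f where "blinfun_apply T f = g /\<^sub>R c"
      by (rule Isom_surjE[OF assms(1)])
    with assms(2) show ?thesis
      by (intro exI[of _ f]) (auto simp: blinfun.scaleR_left)
  qed
  then show ?thesis
    using assms by (auto simp: Isom_def blinfun.scaleR_left surj_def) metis
qed

text \<open>The function \<open>h = 1 - \<bar>T 1\<bar>\<close> is the image of some \<open>k\<close> with \<open>\<parallel>1 \<plusminus> k\<parallel> \<le> 1\<close>, which forces \<open>k = 0\<close>: the unit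
  is an extreme point of the unit ball.\<close>
lemma Isom_unit_abs:
  fixes T :: "('k::topological_space \<Rightarrow>\<^sub>C real) \<Rightarrow>\<^sub>L ('k \<Rightarrow>\<^sub>C real)"
  assumes K: "compact (UNIV :: 'k set)" and T: "T \<in> Isom"
  shows "\<bar>apply_bcontfun (blinfun_apply T (const_bcontfun 1)) t\<bar> = 1"
proof -
  let ?e = "const_bcontfun 1 :: 'k \<Rightarrow>\<^sub>C real"
  define u where "u = blinfun_apply T ?e"
  define h where "h = Bcontfun (\<lambda>x. 1 - \<bar>apply_bcontfun u x\<bar>)"
  have h: "apply_bcontfun h x = 1 - \<bar>apply_bcontfun u x\<bar>" for x
    unfolding h_def by (subst apply_Bcontfun[OF K]) (auto intro!: continuous_intros)
  obtain k where k: "blinfun_apply T k = h"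
    by (rule Isom_surjE[OF T])
  have ule: "\<bar>apply_bcontfun u x\<bar> \<le> 1" for x
  proof -
    have "norm ?e \<le> 1" by (rule norm_bound) simp
    then show ?thesis
      using norm_bounded[of u x] Isom_norm[OF T, of ?e] by (simp add: u_def)
  qed
  have "norm (?e + k) \<le> 1"
  proof -
    have "norm (u + h) \<le> 1"
      by (rule norm_bound) (use ule h in \<open>simp add: abs_le_iff, smt (verit)\<close>)
    then show ?thesis
      using Isom_norm[OF T, of "?e + k"] by (simp add: blinfun.add_right u_def k)
  qed
  moreover have "norm (?e - k) \<le> 1"
  proof -
    have "norm (u - h) \<le> 1"
      by (rule norm_bound) (use ule h in \<open>simp add: abs_le_iff, smt (verit)\<close>)
    then show ?thesis
      using Isom_norm[OF T, of "?e - k"] by (simp add: blinfun.diff_right u_def k)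
  qed
  ultimately have "apply_bcontfun k x = 0" for x
    using norm_bounded[of "?e + k" x] norm_bounded[of "?e - k" x] by simp
  then have "k = 0"
    by (intro bcontfun_eqI) simp
  then have "h = 0"
    using k by simp
  then show ?thesis
    using h[of t] by (simp add: u_def)
qed

text \<open>Connectedness turns the pointwise signs of \<open>Isom_unit_abs\<close> into one global
  sign, which can then be divided out of \<open>T\<close>.\<close>

lemma Isom_unit_const:
  fixes T :: "('k::topological_space \<Rightarrow>\<^sub>C real) \<Rightarrow>\<^sub>L ('k \<Rightarrow>\<^sub>C real)"
  assumes K: "compact (UNIV :: 'k set)" "connected (UNIV :: 'k set)" and T: "T \<in> Isom"
  obtains c where "\<bar>c\<bar> = 1" "blinfun_apply T (const_bcontfun 1) = const_bcontfun c"
proof -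
  let ?u = "apply_bcontfun (blinfun_apply T (const_bcontfun 1))"
  have u: "?u t = 1 \<or> ?u t = -1" for t
    using Isom_unit_abs[OF K(1) T, of t] by linarith
  have "finite (range ?u)"
    by (rule finite_subset[of _ "{1, -1}"]) (use u in auto)
  then have "?u constant_on UNIV"
    using K by (intro continuous_finite_range_constant) auto
  then obtain c where c: "\<And>t. ?u t = c"
    by (auto simp: constant_on_def)
  show ?thesis
  proof
    show "\<bar>c\<bar> = 1"
      using u[of undefined] c by auto
    show "blinfun_apply T (const_bcontfun 1) = const_bcontfun c"
      by (rule bcontfun_eqI) (simp add: c)
  qed
qed

text \<open>With M = \<open>norm f\<close> one has |f| \<le> M, so 0 \<le> f says exactly that |M -
  f| \<le> M. Positivity is thus expressed by the norm and the constants, both of which a unital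
  isometry respects.\<close>

lemma bcontfun_nonneg_iff:
  fixes f :: "'k::topological_space \<Rightarrow>\<^sub>C real"
  shows "(\<forall>x. 0 \<le> apply_bcontfun f x) \<longleftrightarrow> norm (const_bcontfun (norm f) - f) \<le> norm f"
proof
  assume f: "\<forall>x. 0 \<le> apply_bcontfun f x"
  show "norm (const_bcontfun (norm f) - f) \<le> norm f"
  proof (rule norm_bound)
    fix x
    show "norm (apply_bcontfun (const_bcontfun (norm f) - f) x) \<le> norm f"
      using norm_bounded[of f x] f by (simp add: abs_le_iff)
  qed
next
  assume "norm (const_bcontfun (norm f) - f) \<le> norm f"
  then show "\<forall>x. 0 \<le> apply_bcontfun f x"
    using norm_bounded[of "const_bcontfun (norm f) - f"] by (smt (verit) minus_bcontfun.rep_eq const_bcontfun.rep_eq real_norm_def)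
qed

lemma const_bcontfun_eq_scaleR: "const_bcontfun c = c *\<^sub>R (const_bcontfun 1 :: 'k::topological_space \<Rightarrow>\<^sub>C real)"
  by (rule bcontfun_eqI) simp

text \<open>\<open>S\<close> maps M - f to M - S f, where M is the common norm of \<open>f\<close>
  and \<open>S f\<close>. The direction from left to right, positivity of the inverse, is what makes
  \<open>S\<close> a lattice homomorphism.\<close>

lemma unital_Isom_nonneg_iff:
  fixes S :: "('k::topological_space \<Rightarrow>\<^sub>C real) \<Rightarrow>\<^sub>L ('k \<Rightarrow>\<^sub>C real)"
  assumes S: "S \<in> Isom" and S1: "blinfun_apply S (const_bcontfun 1) = const_bcontfun 1"
  shows "(\<forall>x. 0 \<le> apply_bcontfun (blinfun_apply S f) x) \<longleftrightarrow> (\<forall>x. 0 \<le> apply_bcontfun f x)"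
proof -
  have "blinfun_apply S (const_bcontfun (norm f) - f) = const_bcontfun (norm f) - blinfun_apply S f"
    by (metis S1 blinfun.diff_right blinfun.scaleR_right const_bcontfun_eq_scaleR)
  then show ?thesis
    unfolding bcontfun_nonneg_iff by (metis Isom_norm[OF S])
qed

text \<open>If \<open>s = S u (t)\<close> for an embedding \<open>u\<close>, then \<open>\<bar>f - f x\<^sub>0\<bar> \<le> r + C \<bar>u - s\<bar>\<close> for every \<open>r > 0\<close>
  and some \<open>C\<close>; the lattice homomorphism \<open>S\<close> kills the last term at \<open>t\<close>.\<close>
lemma unital_Isom_composition:
  fixes S :: "('k::topological_space \<Rightarrow>\<^sub>C real) \<Rightarrow>\<^sub>L ('k \<Rightarrow>\<^sub>C real)"
    and u :: "'k \<Rightarrow>\<^sub>C real"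
  assumes K: "compact (UNIV :: 'k set)"
    and S: "S \<in> Isom" and S1: "blinfun_apply S (const_bcontfun 1) = const_bcontfun 1"
    and hom: "homeomorphism UNIV {a..b} (apply_bcontfun u) k"
  shows "apply_bcontfun (blinfun_apply S u) t \<in> {a..b}"
    and "apply_bcontfun (blinfun_apply S f) t
           = apply_bcontfun f (k (apply_bcontfun (blinfun_apply S u) t))"
proof -
  note pos = unital_Isom_nonneg_iff[OF S S1]
  have Sc: "blinfun_apply S (const_bcontfun c) = const_bcontfun c" for c
    by (metis S1 blinfun.scaleR_right const_bcontfun_eq_scaleR)
  have uab: "apply_bcontfun u x \<in> {a..b}" for x
    using hom by (auto simp: homeomorphism_def)
  define s where "s = apply_bcontfun (blinfun_apply S u) t"
  have "\<forall>x. 0 \<le> apply_bcontfun (blinfun_apply S (u - const_bcontfun a)) x"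
    unfolding pos using uab by simp
  moreover have "\<forall>x. 0 \<le> apply_bcontfun (blinfun_apply S (const_bcontfun b - u)) x"
    unfolding pos using uab by simp
  ultimately show sab: "apply_bcontfun (blinfun_apply S u) t \<in> {a..b}"
    by (simp add: blinfun.diff_right Sc)
  define x0 where "x0 = k s"
  have ux0: "apply_bcontfun u x0 = s"
    using hom sab by (auto simp: homeomorphism_def x0_def s_def)
  have ku: "k (apply_bcontfun u x) = x" for x
    using hom by (auto simp: homeomorphism_def)
  define w where "w = u - const_bcontfun s"
  define v where "v = Bcontfun (\<lambda>x. \<bar>apply_bcontfun w x\<bar>)"
  have v: "apply_bcontfun v x = \<bar>apply_bcontfun w x\<bar>" for x
    unfolding v_def by (subst apply_Bcontfun[OF K]) (auto intro!: continuous_intros)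
  \<comment> \<open>Surjectivity gives \<open>y\<close> with S y = |S w|. Reflecting positivity
    yields y \<ge> w and y \<ge> -w, so y \<ge> v and S v \<le> |S w|, which is 0 at
    \<open>t\<close> by the choice of \<open>s\<close>.\<close>
  have Sv: "apply_bcontfun (blinfun_apply S v) t = 0"
  proof -
    define z where "z = Bcontfun (\<lambda>x. \<bar>apply_bcontfun (blinfun_apply S w) x\<bar>)"
    have z: "apply_bcontfun z x = \<bar>apply_bcontfun (blinfun_apply S w) x\<bar>" for x
      unfolding z_def by (subst apply_Bcontfun[OF K]) (auto intro!: continuous_intros)
    obtain y where y: "blinfun_apply S y = z"
      by (rule Isom_surjE[OF S])
    have "\<forall>x. 0 \<le> apply_bcontfun (y - w) x"
      by (subst pos[symmetric]) (simp add: blinfun.diff_right y z abs_ge_self)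
    moreover have "\<forall>x. 0 \<le> apply_bcontfun (y + w) x"
      by (subst pos[symmetric]) (simp add: blinfun.add_right y z abs_if)
    ultimately have "\<forall>x. 0 \<le> apply_bcontfun (y - v) x"
      using v by (simp add: abs_le_iff) (smt (verit))
    then have "\<forall>x. 0 \<le> apply_bcontfun (blinfun_apply S (y - v)) x"
      by (rule pos[THEN iffD2])
    then have "apply_bcontfun (blinfun_apply S v) t \<le> apply_bcontfun z t"
      by (simp add: blinfun.diff_right y)
    also have "apply_bcontfun z t = 0"
      by (simp add: z w_def blinfun.diff_right Sc s_def)
    finally show ?thesis
      using pos[of v] v by (simp add: antisym)
  qed
  have "\<bar>apply_bcontfun (blinfun_apply S f) t - apply_bcontfun f x0\<bar> \<le> r" if "r > 0" for r
  proof -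
    have "continuous_on {a..b} (\<lambda>y. apply_bcontfun f (k y))"
      using hom by (intro continuous_on_compose2[OF continuous_on_apply_bcontfun[of UNIV f]])
        (auto simp: homeomorphism_def)
    then obtain d where d: "d > 0" "\<And>y. y \<in> {a..b} \<Longrightarrow> dist y s < d \<Longrightarrow>
        dist (apply_bcontfun f (k y)) (apply_bcontfun f (k s)) < r"
      using sab \<open>r > 0\<close> unfolding continuous_on_iff s_def by blast
    \<comment> \<open>\<open>C * d\<close> is 2 \<open>norm f\<close>, a bound for the oscillation
      of \<open>f\<close>: the term in \<open>v\<close> covers the points where |w| \<ge> d, and
      continuity at \<open>s\<close> covers the others.\<close>
    define C where "C = 2 * norm f / d"
    have C: "C \<ge> 0" using d by (simp add: C_def)
    have est: "\<bar>apply_bcontfun f x - apply_bcontfun f x0\<bar> \<le> r + C * apply_bcontfun v x" for x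
    proof (cases "\<bar>apply_bcontfun w x\<bar> < d")
      case True
      then have "\<bar>apply_bcontfun f x - apply_bcontfun f x0\<bar> < r"
        using d(2)[OF uab[of x]] by (simp add: w_def dist_real_def ku x0_def)
      moreover have "0 \<le> C * apply_bcontfun v x"
        using C by (simp add: v)
      ultimately show ?thesis by linarith
    next
      case False
      then have "C * d \<le> C * apply_bcontfun v x"
        using C by (intro mult_left_mono) (auto simp: v)
      moreover have "C * d = 2 * norm f"
        using d by (simp add: C_def)
      moreover have "\<bar>apply_bcontfun f x - apply_bcontfun f x0\<bar> \<le> 2 * norm f"
        using norm_bounded[of f x] norm_bounded[of f x0] by simp
      ultimately show ?thesis using \<open>r > 0\<close> by linarith
    qed
    define c where "c = apply_bcontfun f x0"
    have "\<forall>x. 0 \<le> apply_bcontfun (const_bcontfun r + C *\<^sub>R v - (f - const_bcontfun c)) x"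
      using est by (simp add: abs_le_iff c_def)
    then have "\<forall>x. 0 \<le> apply_bcontfun (blinfun_apply S (const_bcontfun r + C *\<^sub>R v - (f - const_bcontfun c))) x"
      by (rule pos[THEN iffD2])
    from this[rule_format, of t] have 1: "0 \<le> r - (apply_bcontfun (blinfun_apply S f) t - c)"
      using Sv by (simp add: blinfun.diff_right blinfun.add_right blinfun.scaleR_right Sc)
    have "\<forall>x. 0 \<le> apply_bcontfun (const_bcontfun r + C *\<^sub>R v + (f - const_bcontfun c)) x"
      using est by (simp add: abs_le_iff c_def) (smt (verit))
    then have "\<forall>x. 0 \<le> apply_bcontfun (blinfun_apply S (const_bcontfun r + C *\<^sub>R v + (f - const_bcontfun c))) x"
      by (rule pos[THEN iffD2])
    from this[rule_format, of t] have 2: "0 \<le> r + (apply_bcontfun (blinfun_apply S f) t - c)"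
      using Sv by (simp add: blinfun.diff_right blinfun.add_right blinfun.scaleR_right Sc)
    show ?thesis using 1 2 by (simp add: c_def abs_le_iff)
  qed
  then have "\<bar>apply_bcontfun (blinfun_apply S f) t - apply_bcontfun f x0\<bar> \<le> 0"
    by (metis field_le_epsilon add_0)
  then show "apply_bcontfun (blinfun_apply S f) t
           = apply_bcontfun f (k (apply_bcontfun (blinfun_apply S u) t))"
    by (simp add: x0_def s_def)
qed

section \<open>Operator topologies\<close>

lemma openin_weak_operator_topology_apply:
  fixes f :: "'b::real_normed_vector \<Rightarrow>\<^sub>L real" and x :: "'a::real_normed_vector"
  assumes "open U"
  shows "openin weak_operator_topology {T. blinfun_apply f (blinfun_apply T x) \<in> U}"
  unfolding weak_operator_topology_def openin_topology_generated_by_iff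
  using assms by (intro generate_topology_on.Basis) blast

lemma topspace_weak_operator_topology: "topspace weak_operator_topology = UNIV"
  using openin_weak_operator_topology_apply[of UNIV 0 0] openin_subset by force

lemma weak_le_strong_operator_topology:
  assumes "openin weak_operator_topology W"
  shows "openin strong_operator_topology W"
proof -
  have "generate_topology_on {{T. blinfun_apply f (blinfun_apply T x) \<in> U} | (x :: 'a) (f :: 'b \<Rightarrow>\<^sub>L real) U. open U} W"
    using assms by (simp add: weak_operator_topology_def openin_topology_generated_by_iff)
  then show ?thesis
  proof induction
    case (Basis s)
    then obtain x :: 'a and f :: "'b \<Rightarrow>\<^sub>L real" and U where
      s: "s = {T. blinfun_apply f (blinfun_apply T x) \<in> U}" "open U" by blast
    have "continuous_map strong_operator_topology euclidean (blinfun_apply f \<circ> (\<lambda>T. blinfun_apply T x))"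
      by (intro continuous_map_compose[OF strong_operator_topology_continuous_evaluation])
        (simp add: linear_continuous_on blinfun.bounded_linear_right)
    from openin_continuous_map_preimage[OF this, of U] s show ?case
      by (simp add: strong_operator_topology_topspace)
  qed (auto intro: openin_Int)
qed

text \<open>The weak topology is always the coarser one, so only the weak-to-norm continuity of each
  evaluation on \<open>G\<close> has to be supplied.\<close>

lemma light_groupI:
  fixes G :: "('a::real_normed_vector \<Rightarrow>\<^sub>L 'a) set"
  assumes "\<And>T0 x r. T0 \<in> G \<Longrightarrow> r > 0 \<Longrightarrow>
    \<exists>N. openin weak_operator_topology N \<and> T0 \<in> N \<and>
      (\<forall>T\<in>N \<inter> G. norm (blinfun_apply T x - blinfun_apply T0 x) < r)"
  shows "light_group G"
proof -
  have "continuous_map (subtopology weak_operator_topology G) euclidean (\<lambda>T. blinfun_apply T x)" for x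
    unfolding continuous_map
  proof (intro conjI allI impI)
    fix U :: "'a set" assume "openin euclidean U"
    then have U: "open U" by simp
    show "openin (subtopology weak_operator_topology G)
       {T \<in> topspace (subtopology weak_operator_topology G). blinfun_apply T x \<in> U}"
      unfolding topspace_subtopology topspace_weak_operator_topology
    proof (subst openin_subopen, safe)
      fix T0 assume T0: "T0 \<in> G" "blinfun_apply T0 x \<in> U"
      with U obtain r where r: "r > 0" "ball (blinfun_apply T0 x) r \<subseteq> U"
        by (meson open_contains_ball)
      from assms[OF T0(1) r(1), of x] obtain N where
        N: "openin weak_operator_topology N" "T0 \<in> N"
          "\<And>T. T \<in> N \<inter> G \<Longrightarrow> norm (blinfun_apply T x - blinfun_apply T0 x) < r" by blast
      have "blinfun_apply T x \<in> U" if "T \<in> N \<inter> G" for T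
        using N(3)[OF that] r(2) by (auto simp: dist_norm norm_minus_commute subset_iff)
      then show "\<exists>W. openin (subtopology weak_operator_topology G) W \<and> T0 \<in> W \<and>
          W \<subseteq> {T \<in> UNIV \<inter> G. blinfun_apply T x \<in> U}"
        using N T0 by (intro exI[of _ "N \<inter> G"]) (auto simp: openin_subtopology)
    qed
  qed simp
  then have "continuous_map (subtopology weak_operator_topology G) strong_operator_topology (\<lambda>T. T)"
    by (simp add: continuous_on_strong_operator_topo_iff_coordinatewise)
  then have "openin (subtopology weak_operator_topology G) (W \<inter> G)"
    if "openin strong_operator_topology W" for W
    using openin_continuous_map_preimage[OF _ that] 
    by (fastforce simp: topspace_weak_operator_topology Int_def conj_commute)
  then have "openin (subtopology strong_operator_topology G) V \<Longrightarrow>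
    openin (subtopology weak_operator_topology G) V" for V
    by (auto simp: openin_subtopology)
  moreover have "openin (subtopology weak_operator_topology G) V \<Longrightarrow>
    openin (subtopology strong_operator_topology G) V" for V
    using weak_le_strong_operator_topology by (auto simp: openin_subtopology)
  ultimately show ?thesis
    unfolding light_group_def topology_eq by blast
qed


text \<open>The operators sending \<open>x\<close> into the ball of radius \<open>e\<close> about
  \<open>T0 x\<close> form a strongly open set that contains \<open>T0\<close> but no
  \<open>T k\<close>. If the topologies agreed on \<open>G\<close>, weak convergence would bring
  some \<open>T k\<close> into it.\<close>

lemma not_light_groupI:
  fixes T :: "nat \<Rightarrow> 'a::real_normed_vector \<Rightarrow>\<^sub>L 'a"
  assumes T: "\<And>k. T k \<in> G" "T0 \<in> G"
    and weak: "\<And>(f :: 'a \<Rightarrow>\<^sub>L real) x. (\<lambda>k. blinfun_apply f (blinfun_apply (T k) x)) \<longlonglongrightarrow> blinfun_apply f (blinfun_apply T0 x)"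
    and far: "e > 0" "\<And>k. e \<le> norm (blinfun_apply (T k) x - blinfun_apply T0 x)"
  shows "\<not> light_group G"
proof
  assume light: "light_group G"
  \<comment> \<open>Induction over the generation of the topology: a union uses the one member that
    contains \<open>T0\<close>, and the subbasic sets are handled by \<open>weak\<close>.\<close>
  have ev: "\<forall>\<^sub>F k in sequentially. T k \<in> W" if "openin weak_operator_topology W" "T0 \<in> W" for W
  proof -
    have "generate_topology_on {{T. blinfun_apply f (blinfun_apply T x) \<in> U} | (x :: 'a) (f :: 'a \<Rightarrow>\<^sub>L real) U. open U} W"
      using that by (simp add: weak_operator_topology_def openin_topology_generated_by_iff)
    then show ?thesis
      using \<open>T0 \<in> W\<close>
    proof induction
      case (Int a b)
      then show ?case by (auto intro: eventually_conj)
    next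
      case (UN \<K>)
      then obtain a where "a \<in> \<K>" "\<forall>\<^sub>F k in sequentially. T k \<in> a" by blast
      then show ?case by (auto elim: eventually_mono)
    next
      case (Basis s)
      then obtain x :: 'a and f :: "'a \<Rightarrow>\<^sub>L real" and U where s: "s = {T. blinfun_apply f (blinfun_apply T x) \<in> U}" "open U" by blast
      with Basis(2) topological_tendstoD[OF weak[of f x], of U] show ?case by simp
    qed simp
  qed
  have "continuous_map strong_operator_topology euclidean (\<lambda>T. blinfun_apply T x)"
    by (rule strong_operator_topology_continuous_evaluation)
  from openin_continuous_map_preimage[OF this, of "ball (blinfun_apply T0 x) e"]
  have "openin strong_operator_topology {T. blinfun_apply T x \<in> ball (blinfun_apply T0 x) e}"
    by (simp add: strong_operator_topology_topspace)
  then have "openin (subtopology weak_operator_topology G) ({T. blinfun_apply T x \<in> ball (blinfun_apply T0 x) e} \<inter> G)"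
    using light unfolding light_group_def by (metis openin_subtopology)
  then obtain W where W: "openin weak_operator_topology W"
    "{T. blinfun_apply T x \<in> ball (blinfun_apply T0 x) e} \<inter> G = W \<inter> G"
    by (auto simp: openin_subtopology)
  have "T0 \<in> W"
    using W(2) T(2) far(1) by auto
  then obtain k where "T k \<in> W"
    using ev[OF W(1)] eventually_happens'[OF sequentially_bot] by blast
  then have "T k \<in> {T. blinfun_apply T x \<in> ball (blinfun_apply T0 x) e}"
    using W(2) T(1) by blast
  then show False
    using far(2)[of k] by (simp add: dist_norm norm_minus_commute)
qed

section \<open>Lightness over an interval\<close>

text \<open>Multiplied by its sign, the operator is unital and hence a composition operator;
  \<open>k\<close> transports this to the interval, where the order of the line is available for
  \<open>p\<close>.\<close>

lemma Isom_interval_composition: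
  fixes T :: "('k::topological_space \<Rightarrow>\<^sub>C real) \<Rightarrow>\<^sub>L ('k \<Rightarrow>\<^sub>C real)"
    and u :: "'k \<Rightarrow>\<^sub>C real"
  assumes K: "compact (UNIV :: 'k set)" "connected (UNIV :: 'k set)"
    and hom: "homeomorphism UNIV {a..b} (apply_bcontfun u) k"
    and T: "T \<in> Isom"
  obtains c p where "\<bar>c\<bar> = 1" "blinfun_apply T (const_bcontfun 1) = const_bcontfun c"
    "continuous_on {a..b} p" "inj_on p {a..b}" "p \<in> {a..b} \<rightarrow> {a..b}"
    "\<And>s. p s = c * apply_bcontfun (blinfun_apply T u) (k s)"
    "\<And>f s. apply_bcontfun (blinfun_apply T f) (k s) = c * apply_bcontfun f (k (p s))"
proof -
  obtain c where c: "\<bar>c\<bar> = 1" "blinfun_apply T (const_bcontfun 1) = const_bcontfun c"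
    by (rule Isom_unit_const[OF K T])
  have cc: "c * c = 1"
    using c(1) by (metis abs_mult_self_eq mult_1)
  define S where "S = c *\<^sub>R T"
  have S: "S \<in> Isom"
    unfolding S_def by (rule Isom_scaleR[OF T c(1)])
  have S1: "blinfun_apply S (const_bcontfun 1) = const_bcontfun 1"
    by (rule bcontfun_eqI) (simp add: S_def blinfun.scaleR_left c(2) cc)
  note rep = unital_Isom_composition[OF K(1) S S1 hom]
  define p where "p = (\<lambda>s. apply_bcontfun (blinfun_apply S u) (k s))"
  have p: "p s = c * apply_bcontfun (blinfun_apply T u) (k s)" for s
    by (simp add: p_def S_def blinfun.scaleR_left)
  have Sp: "apply_bcontfun (blinfun_apply S f) (k s) = apply_bcontfun f (k (p s))" for f s
    unfolding p_def by (rule rep(2))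
  have k: "continuous_on {a..b} k" "\<And>s. s \<in> {a..b} \<Longrightarrow> apply_bcontfun u (k s) = s"
    using hom by (auto simp: homeomorphism_def)
  show ?thesis
  proof
    show "\<bar>c\<bar> = 1" "blinfun_apply T (const_bcontfun 1) = const_bcontfun c" by fact+
    show "continuous_on {a..b} p"
      unfolding p_def using k(1)
      by (rule continuous_on_compose2[OF continuous_on_apply_bcontfun[of UNIV]]) auto
    show "p \<in> {a..b} \<rightarrow> {a..b}"
      using rep(1) by (auto simp: p_def)
    \<comment> \<open>Injectivity of \<open>p\<close> comes from surjectivity of \<open>S\<close>:
      if S f = u, then f (k (p s)) = s, so \<open>p s\<close> determines \<open>s\<close>.\<close>
    show "inj_on p {a..b}"
    proof (rule inj_onI)
      fix s s' assume *: "s \<in> {a..b}" "s' \<in> {a..b}" "p s = p s'"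
      obtain f where "blinfun_apply S f = u"
        by (rule Isom_surjE[OF S])
      then show "s = s'"
        using Sp[of f s] Sp[of f s'] * k(2) by metis
    qed
    show "p s = c * apply_bcontfun (blinfun_apply T u) (k s)" for s by (rule p)
    show "apply_bcontfun (blinfun_apply T f) (k s) = c * apply_bcontfun f (k (p s))" for f s
    proof -
      have "apply_bcontfun f (k (p s)) = c * apply_bcontfun (blinfun_apply T f) (k s)"
        using Sp[of f s] by (simp add: S_def blinfun.scaleR_left)
      then show ?thesis
        by (metis cc mult.assoc mult_1)
    qed
  qed
qed

text \<open>Bisection: nets of adjacent intervals can be united, and on a short interval the two end
  points suffice. Each \<open>t\<close> is bracketed from both sides so that a monotone map can be
  estimated at \<open>t\<close> from its values on the net.\<close>

lemma continuous_on_interval_net: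
  fixes g :: "real \<Rightarrow> real"
  assumes "a \<le> b" "continuous_on {a..b} g" "e > 0"
  obtains F where "finite F" "F \<subseteq> {a..b}"
    "\<And>t. t \<in> {a..b} \<Longrightarrow> \<exists>u\<in>F. \<exists>v\<in>F. u \<le> t \<and> t \<le> v \<and> \<bar>g u - g t\<bar> < e \<and> \<bar>g v - g t\<bar> < e"
proof -
  \<comment> \<open>The bounds are premises inside \<open>P\<close> because \<open>Bolzano\<close>
    also asks about intervals that stick out of {a..b}; for these \<open>P\<close> is
    vacuous.\<close>
  define P where "P = (\<lambda>x y. a \<le> x \<longrightarrow> y \<le> b \<longrightarrow> (\<exists>F. finite F \<and> F \<subseteq> {x..y} \<and>
    (\<forall>t\<in>{x..y}. \<exists>u\<in>F. \<exists>v\<in>F. u \<le> t \<and> t \<le> v \<and> \<bar>g u - g t\<bar> < e \<and> \<bar>g v - g t\<bar> < e)))"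
  have "P a b"
    using \<open>a \<le> b\<close>
  proof (induction rule: Bolzano)
    case (trans x y z)
    show ?case
      unfolding P_def
    proof (intro impI)
      assume "a \<le> x" "z \<le> b"
      then have "a \<le> y" "y \<le> b"
        using trans(3,4) by simp_all
      with trans(1,2) \<open>a \<le> x\<close> \<open>z \<le> b\<close> obtain F G where F: "finite F" "F \<subseteq> {x..y}"
        "\<forall>t\<in>{x..y}. \<exists>u\<in>F. \<exists>v\<in>F. u \<le> t \<and> t \<le> v \<and> \<bar>g u - g t\<bar> < e \<and> \<bar>g v - g t\<bar> < e"
        and G: "finite G" "G \<subseteq> {y..z}"
        "\<forall>t\<in>{y..z}. \<exists>u\<in>G. \<exists>v\<in>G. u \<le> t \<and> t \<le> v \<and> \<bar>g u - g t\<bar> < e \<and> \<bar>g v - g t\<bar> < e"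
        unfolding P_def by blast
      have FG: "F \<union> G \<subseteq> {x..z}"
        using order_trans[OF F(2), of "{x..z}"] order_trans[OF G(2), of "{x..z}"] trans(3,4) by auto
      have "\<exists>u\<in>F \<union> G. \<exists>v\<in>F \<union> G. u \<le> t \<and> t \<le> v \<and> \<bar>g u - g t\<bar> < e \<and> \<bar>g v - g t\<bar> < e"
        if "t \<in> {x..z}" for t
      proof (cases "t \<le> y")
        case True
        with that F(3) show ?thesis by (meson UnI1 atLeastAtMost_iff)
      next
        case False
        with that G(3) show ?thesis by (meson UnI2 atLeastAtMost_iff nle_le)
      qed
      then show "\<exists>F. finite F \<and> F \<subseteq> {x..z} \<and>
        (\<forall>t\<in>{x..z}. \<exists>u\<in>F. \<exists>v\<in>F. u \<le> t \<and> t \<le> v \<and> \<bar>g u - g t\<bar> < e \<and> \<bar>g v - g t\<bar> < e)"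
        using F(1) G(1) FG by (intro exI[of _ "F \<union> G"]) auto
    qed
  next
    case (local x)
    then have "x \<in> {a..b}" by simp
    then obtain d where d: "d > 0" "\<And>y. y \<in> {a..b} \<Longrightarrow> dist y x < d \<Longrightarrow> dist (g y) (g x) < e / 2"
      using assms(2)[unfolded continuous_on_iff, rule_format, of x "e / 2"] assms(3) by auto
    have "P y z" if yz: "y \<le> x" "x \<le> z" "z - y < d" for y z
      unfolding P_def
    proof (intro impI)
      assume "a \<le> y" "z \<le> b"
      have "dist (g t) (g x) < e / 2" if "t \<in> {y..z}" for t
        using d(2)[of t] that yz \<open>a \<le> y\<close> \<open>z \<le> b\<close> by (simp add: dist_real_def abs_less_iff)
      then have near: "\<bar>g t - g x\<bar> < e / 2" if "t \<in> {y..z}" for t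
        using that by (simp add: dist_real_def)
      have "\<bar>g t - g s\<bar> < e" if "t \<in> {y..z}" "s \<in> {y..z}" for s t
        using near[OF that(1)] near[OF that(2)] by linarith
      then show "\<exists>F. finite F \<and> F \<subseteq> {y..z} \<and>
        (\<forall>t\<in>{y..z}. \<exists>u\<in>F. \<exists>v\<in>F. u \<le> t \<and> t \<le> v \<and> \<bar>g u - g t\<bar> < e \<and> \<bar>g v - g t\<bar> < e)"
        using yz by (intro exI[of _ "{y, z}"]) auto
    qed
    then show ?case using d(1) by blast
  qed
  then show ?thesis
    unfolding P_def using that by auto
qed

text \<open>Points as elements of the dual: conditions on finitely many values of \<open>T g\<close>
  become weakly open.\<close>

definition eval_blinfun :: "'k::topological_space \<Rightarrow> ('k \<Rightarrow>\<^sub>C real) \<Rightarrow>\<^sub>L real" where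
  "eval_blinfun x = Blinfun (\<lambda>f. apply_bcontfun f x)"

lemma eval_blinfun_apply [simp]: "blinfun_apply (eval_blinfun x) f = apply_bcontfun f x"
proof -
  have "bounded_linear (\<lambda>f. apply_bcontfun f x :: real)"
    by (rule bounded_linear_intro[where K = 1]) (use norm_bounded[where 'b = real] in auto)
  then show ?thesis
    by (simp add: eval_blinfun_def bounded_linear_Blinfun_apply)
qed

text \<open>The maps \<open>p\<close> above are monotone, so closeness on the points of a fine enough net, which is a
  weakly open condition, gives uniform closeness.\<close>
lemma light_space_interval:
  fixes u :: "'k::topological_space \<Rightarrow>\<^sub>C real"
  assumes K: "compact (UNIV :: 'k set)" "connected (UNIV :: 'k set)"
    and hom: "homeomorphism UNIV {a..b} (apply_bcontfun u) k"
  shows "light_space TYPE('k \<Rightarrow>\<^sub>C real)"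
  unfolding light_space_def
proof (rule light_groupI)
  fix T0 :: "('k \<Rightarrow>\<^sub>C real) \<Rightarrow>\<^sub>L ('k \<Rightarrow>\<^sub>C real)" and f :: "'k \<Rightarrow>\<^sub>C real" and r :: real
  assume T0: "T0 \<in> Isom" and r: "r > 0"
  obtain c0 p0 where c0: "\<bar>c0\<bar> = 1" "blinfun_apply T0 (const_bcontfun 1) = const_bcontfun c0"
    and p0: "continuous_on {a..b} p0" "inj_on p0 {a..b}" "p0 \<in> {a..b} \<rightarrow> {a..b}"
    "\<And>s. p0 s = c0 * apply_bcontfun (blinfun_apply T0 u) (k s)"
    "\<And>f s. apply_bcontfun (blinfun_apply T0 f) (k s) = c0 * apply_bcontfun f (k (p0 s))"
    by (rule Isom_interval_composition[OF K hom T0]) blast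
  have ku: "k (apply_bcontfun u x) = x" "apply_bcontfun u x \<in> {a..b}" for x
    using hom by (auto simp: homeomorphism_def)
  have ab: "a \<le> b"
    using ku(2) by (metis atLeastAtMost_iff order_trans)
  have "continuous_on {a..b} (\<lambda>s. apply_bcontfun f (k s))"
    using hom by (intro continuous_on_compose2[OF continuous_on_apply_bcontfun[of UNIV f]])
      (auto simp: homeomorphism_def)
  then have "uniformly_continuous_on {a..b} (\<lambda>s. apply_bcontfun f (k s))"
    by (intro compact_uniformly_continuous) auto
  then obtain d where d: "d > 0"
    "\<And>s s'. s \<in> {a..b} \<Longrightarrow> s' \<in> {a..b} \<Longrightarrow> \<bar>s - s'\<bar> < d \<Longrightarrow>
       \<bar>apply_bcontfun f (k s) - apply_bcontfun f (k s')\<bar> < r / 2"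
    using r unfolding uniformly_continuous_on_def dist_real_def by (metis half_gt_zero)
  obtain F where F: "finite F" "F \<subseteq> {a..b}" "\<And>t. t \<in> {a..b} \<Longrightarrow>
      \<exists>v\<in>F. \<exists>w\<in>F. v \<le> t \<and> t \<le> w \<and> \<bar>p0 v - p0 t\<bar> < d / 2 \<and> \<bar>p0 w - p0 t\<bar> < d / 2"
    using continuous_on_interval_net[OF ab p0(1), of "d / 2"] d(1) by auto
  define near where "near = (\<lambda>g x e. {T. blinfun_apply (eval_blinfun x) (blinfun_apply T g)
     \<in> ball (apply_bcontfun (blinfun_apply T0 g) x) e})"
  have near_open: "openin weak_operator_topology (near g x e)" for g x e
    unfolding near_def by (rule openin_weak_operator_topology_apply) simp
  \<comment> \<open>The first factor fixes the sign, since distinct signs differ by 2; the others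
    control \<open>p\<close> on the net.\<close>
  define N where "N = near (const_bcontfun 1) (k a) 1 \<inter> (\<Inter>v\<in>F. near u (k v) (d / 2))"
  have "F \<noteq> {}"
    using F(3)[of a] ab by auto
  then have "openin weak_operator_topology N"
    unfolding N_def using F(1) near_open by (intro openin_Int openin_INT) auto
  moreover have "T0 \<in> N"
    using d(1) by (simp add: N_def near_def)
  moreover have "norm (blinfun_apply T f - blinfun_apply T0 f) < r" if TN: "T \<in> N \<inter> Isom" for T
  proof -
    have T: "T \<in> Isom" using TN by simp
    obtain c p where c: "\<bar>c\<bar> = 1" "blinfun_apply T (const_bcontfun 1) = const_bcontfun c"
      and p: "continuous_on {a..b} p" "inj_on p {a..b}" "p \<in> {a..b} \<rightarrow> {a..b}"
      "\<And>s. p s = c * apply_bcontfun (blinfun_apply T u) (k s)"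
      "\<And>f s. apply_bcontfun (blinfun_apply T f) (k s) = c * apply_bcontfun f (k (p s))"
      by (rule Isom_interval_composition[OF K hom T]) blast
    have "T \<in> near (const_bcontfun 1) (k a) 1"
      using TN by (simp add: N_def)
    then have "\<bar>c0 - c\<bar> < 1"
      by (simp add: near_def dist_real_def c c0)
    then have cc: "c = c0"
      using c(1) c0(1) by linarith
    have pF: "\<bar>p v - p0 v\<bar> < d / 2" if "v \<in> F" for v
    proof -
      have "T \<in> near u (k v) (d / 2)"
        using TN that by (simp add: N_def)
      then have "\<bar>apply_bcontfun (blinfun_apply T0 u) (k v) - apply_bcontfun (blinfun_apply T u) (k v)\<bar> < d / 2"
        by (simp add: near_def dist_real_def)
      moreover have "p v - p0 v = c * (apply_bcontfun (blinfun_apply T u) (k v) - apply_bcontfun (blinfun_apply T0 u) (k v))"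
        using p(4)[of v] p0(4)[of v] by (simp add: cc right_diff_distrib)
      ultimately show ?thesis
        using c(1) by (simp add: abs_mult abs_minus_commute)
    qed
    have close: "\<bar>p t - p0 t\<bar> < d" if t: "t \<in> {a..b}" for t
    proof -
      obtain v w where vw: "v \<in> F" "w \<in> F" "v \<le> t" "t \<le> w"
        "\<bar>p0 v - p0 t\<bar> < d / 2" "\<bar>p0 w - p0 t\<bar> < d / 2"
        using F(3)[OF t] by blast
      have vw_ab: "{v..w} \<subseteq> {a..b}"
        using vw F(2) by auto
      \<comment> \<open>\<open>continuous_inj_imp_mono\<close> needs strict inequalities, so the
        cases where \<open>t\<close> equals one of the bracketing points are split off.\<close>
      have "p v \<le> p t \<and> p t \<le> p w \<or> p w \<le> p t \<and> p t \<le> p v"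
      proof (cases "v = t \<or> t = w")
        case True
        then show ?thesis by auto
      next
        case False
        then have "v < t" "t < w" using vw by auto
        from continuous_inj_imp_mono[OF this continuous_on_subset[OF p(1) vw_ab]
            inj_on_subset[OF p(2) vw_ab]]
        show ?thesis by auto
      qed
      then show ?thesis
        using pF[OF vw(1)] pF[OF vw(2)] vw(5,6) by linarith
    qed
    \<comment> \<open>Strict pointwise bounds give only a weak bound on the supremum, hence
      \<open>r / 2\<close>.\<close>
    have "norm (blinfun_apply T f - blinfun_apply T0 f) \<le> r / 2"
    proof (rule norm_bound)
      fix x
      define t where "t = apply_bcontfun u x"
      have t: "t \<in> {a..b}" "x = k t"
        by (simp_all add: t_def ku) (use ku in auto)
      have "apply_bcontfun (blinfun_apply T f - blinfun_apply T0 f) x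
          = c0 * (apply_bcontfun f (k (p t)) - apply_bcontfun f (k (p0 t)))"
        by (simp add: t(2) p(5) p0(5) cc right_diff_distrib)
      then have "norm (apply_bcontfun (blinfun_apply T f - blinfun_apply T0 f) x)
          = \<bar>apply_bcontfun f (k (p t)) - apply_bcontfun f (k (p0 t))\<bar>"
        by (simp add: abs_mult c0)
      also have "\<dots> < r / 2"
        using t(1) p(3) p0(3) close by (intro d(2)) auto
      finally show "norm (apply_bcontfun (blinfun_apply T f - blinfun_apply T0 f) x) \<le> r / 2"
        by simp
    qed
    then show ?thesis using r by linarith
  qed
  ultimately show "\<exists>N. openin weak_operator_topology N \<and> T0 \<in> N \<and>
      (\<forall>T\<in>N \<inter> Isom. norm (blinfun_apply T f - blinfun_apply T0 f) < r)"
    by blast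
qed

text \<open>A compact connected subset of the line is a closed interval.\<close>

lemma light_space_segments:
  assumes K: "compact (UNIV :: 'k::t2_space set)" "connected (UNIV :: 'k set)"
    and hom: "(UNIV :: 'k set) homeomorphic (J :: real set)"
  shows "light_space TYPE('k \<Rightarrow>\<^sub>C real)"
proof -
  obtain j k where jk: "homeomorphism (UNIV :: 'k set) J j k"
    using hom by (auto simp: homeomorphic_def)
  have "connected J" "compact J"
    using hom K homeomorphic_connectedness homeomorphic_compactness by blast+
  then obtain a b where "J = {a..b}"
    by (metis connected_compact_interval_1 cbox_interval)
  moreover have "apply_bcontfun (Bcontfun j) = j"
    using jk by (intro apply_Bcontfun[OF K(1)]) (simp add: homeomorphism_def)
  ultimately show ?thesis
    using light_space_interval[OF K, of a b "Bcontfun j" k] jk by simp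
qed

section \<open>Weakly null perturbations of the identity\<close>

lemma disjoint_supports_weakly_null:
  fixes h :: "nat \<Rightarrow> 'k::topological_space \<Rightarrow>\<^sub>C real" and f :: "('k \<Rightarrow>\<^sub>C real) \<Rightarrow>\<^sub>L real"
  assumes bound: "\<And>k. norm (h k) \<le> C"
    and disj: "\<And>j k x. j \<noteq> k \<Longrightarrow> apply_bcontfun (h j) x = 0 \<or> apply_bcontfun (h k) x = 0"
  shows "(\<lambda>k. blinfun_apply f (h k)) \<longlonglongrightarrow> 0"
proof -
  have C: "C \<ge> 0"
    using bound[of 0] norm_ge_zero order_trans by blast
  have "(\<Sum>k<n. \<bar>blinfun_apply f (h k)\<bar>) \<le> norm f * C" for n
  proof -
    \<comment> \<open>The signs turn \<open>f g\<close> into the sum of the absolute values, while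
      disjointness of the supports keeps \<open>norm g\<close> at most \<open>C\<close> however many
      terms are taken.\<close>
    define g where "g = (\<Sum>k<n. sgn (blinfun_apply f (h k)) *\<^sub>R h k)"
    have "norm g \<le> C"
    proof (rule norm_bound)
      fix x
      have gx: "apply_bcontfun g x = (\<Sum>k<n. sgn (blinfun_apply f (h k)) * apply_bcontfun (h k) x)"
        using blinfun.sum_right[of "eval_blinfun x" "\<lambda>k. sgn (blinfun_apply f (h k)) *\<^sub>R h k" "{..<n}"]
        by (simp add: g_def)
      show "norm (apply_bcontfun g x) \<le> C"
      proof (cases "\<exists>j<n. apply_bcontfun (h j) x \<noteq> 0")
        case True
        then obtain j where j: "j < n" "apply_bcontfun (h j) x \<noteq> 0" by blast
        then have others: "apply_bcontfun (h k) x = 0" if "k \<noteq> j" for k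
          using disj[OF that, of x] by simp
        have "apply_bcontfun g x = (\<Sum>k\<in>{j}. sgn (blinfun_apply f (h k)) * apply_bcontfun (h k) x)"
          unfolding gx by (rule sum.mono_neutral_right) (use j(1) others in auto)
        then have "\<bar>apply_bcontfun g x\<bar> \<le> 1 * norm (apply_bcontfun (h j) x)"
          by (simp add: abs_mult sgn_real_def)
        then show ?thesis
          using norm_bounded[of "h j" x] bound[of j] by simp
      next
        case False
        then show ?thesis
          using C by (simp add: gx)
      qed
    qed
    moreover have "blinfun_apply f g = (\<Sum>k<n. \<bar>blinfun_apply f (h k)\<bar>)"
      by (simp add: g_def blinfun.sum_right blinfun.scaleR_right abs_sgn mult.commute)
    ultimately show ?thesis
      using norm_blinfun[of f g] mult_left_mono[of "norm g" C "norm f"] by simp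
  qed
  then have "summable (\<lambda>k. \<bar>blinfun_apply f (h k)\<bar>)"
    by (intro summableI_nonneg_bounded) auto
  then show ?thesis
    using summable_LIMSEQ_zero tendsto_rabs_zero_iff by blast
qed

section \<open>Composition operators\<close>

definition comp_blinfun :: "('k::topological_space \<Rightarrow> 'k) \<Rightarrow> ('k \<Rightarrow>\<^sub>C real) \<Rightarrow>\<^sub>L ('k \<Rightarrow>\<^sub>C real)" where
  "comp_blinfun p = Blinfun (\<lambda>f. Bcontfun (\<lambda>x. apply_bcontfun f (p x)))"

lemma comp_blinfun_apply:
  fixes p :: "'k::topological_space \<Rightarrow> 'k"
  assumes K: "compact (UNIV :: 'k set)" and p: "continuous_on UNIV p"
  shows "apply_bcontfun (blinfun_apply (comp_blinfun p) f) x = apply_bcontfun f (p x)"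
proof -
  define c where "c = (\<lambda>f :: 'k \<Rightarrow>\<^sub>C real. Bcontfun (\<lambda>x. apply_bcontfun f (p x)))"
  have c: "apply_bcontfun (c f) x = apply_bcontfun f (p x)" for f x
    unfolding c_def
    by (subst apply_Bcontfun[OF K])
      (auto intro!: continuous_on_compose2[OF continuous_on_apply_bcontfun[of UNIV] p])
  have "bounded_linear c"
  proof (rule bounded_linear_intro[where K = 1])
    show "norm (c f) \<le> norm f * 1" for f
      by (rule norm_bound) (use norm_bounded[where 'b = real] in \<open>simp add: c\<close>)
  qed (auto intro!: bcontfun_eqI simp: c)
  then show ?thesis
    by (simp add: comp_blinfun_def bounded_linear_Blinfun_apply c flip: c_def)
qed

text \<open>Surjectivity rests on the continuity of \<open>inv p\<close>: a continuous bijection of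
  a compact Hausdorff space is a homeomorphism.\<close>

lemma comp_blinfun_Isom:
  fixes p :: "'k::t2_space \<Rightarrow> 'k"
  assumes K: "compact (UNIV :: 'k set)" and p: "continuous_on UNIV p" "bij p"
  shows "comp_blinfun p \<in> Isom"
proof -
  note ap = comp_blinfun_apply[OF K p(1)]
  have "norm (blinfun_apply (comp_blinfun p) f) = norm f" for f
  proof (rule antisym)
    show "norm (blinfun_apply (comp_blinfun p) f) \<le> norm f"
      by (rule norm_bound) (use norm_bounded[where 'b = real] in \<open>simp add: ap\<close>)
    show "norm f \<le> norm (blinfun_apply (comp_blinfun p) f)"
    proof (rule norm_bound)
      fix x
      obtain y where "x = p y"
        using p(2) by (metis bij_pointE)
      then show "norm (apply_bcontfun f x) \<le> norm (blinfun_apply (comp_blinfun p) f)"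
        using norm_bounded[of "blinfun_apply (comp_blinfun p) f" y] by (simp add: ap)
    qed
  qed
  moreover have "\<exists>f. g = blinfun_apply (comp_blinfun p) f" for g
  proof -
    have "continuous_on (range p) (inv p)"
      using p K by (intro continuous_on_inv) (auto simp: bij_is_inj)
    then have q: "continuous_on UNIV (inv p)"
      using p(2) by (simp add: bij_is_surj)
    show ?thesis
      by (intro exI[of _ "blinfun_apply (comp_blinfun (inv p)) g"] bcontfun_eqI)
        (simp add: ap comp_blinfun_apply[OF K q] p(2) bij_is_inj)
  qed
  ultimately show ?thesis
    by (auto simp: Isom_def surj_def)
qed

text \<open>Where \<open>p k\<close> fixes a point, the difference of \<open>g\<close> composed with
  \<open>p k\<close> and \<open>g\<close> vanishes; so for each \<open>g\<close> these differences
  have disjoint supports and norm at most 2 \<open>norm g\<close>. The single function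
  \<open>f\<close> refutes strong convergence.\<close>

lemma not_light_space_disjoint_moves:
  fixes p :: "nat \<Rightarrow> 'k::t2_space \<Rightarrow> 'k" and f :: "'k \<Rightarrow> real"
  assumes K: "compact (UNIV :: 'k set)"
    and p: "\<And>k. continuous_on UNIV (p k)" "\<And>k. bij (p k)"
    and disj: "\<And>j k x. j \<noteq> k \<Longrightarrow> p j x = x \<or> p k x = x"
    and f: "continuous_on UNIV f" "e > 0" "\<And>k. \<exists>x. e \<le> \<bar>f (p k x) - f x\<bar>"
  shows "\<not> light_space TYPE('k \<Rightarrow>\<^sub>C real)"
  unfolding light_space_def
proof (rule not_light_groupI)
  note ap = comp_blinfun_apply[OF K p(1)]
  show "comp_blinfun (p k) \<in> Isom" for k
    by (rule comp_blinfun_Isom[OF K p])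
  show "id_blinfun \<in> Isom"
    by (simp add: Isom_def surj_def)
  show "e > 0" by fact
  fix l :: "('k \<Rightarrow>\<^sub>C real) \<Rightarrow>\<^sub>L real" and g :: "'k \<Rightarrow>\<^sub>C real"
  have "(\<lambda>k. blinfun_apply l (blinfun_apply (comp_blinfun (p k)) g - g)) \<longlonglongrightarrow> 0"
  proof (rule disjoint_supports_weakly_null)
    show "norm (blinfun_apply (comp_blinfun (p k)) g - g) \<le> norm g + norm g" for k
      using norm_triangle_ineq4[of "blinfun_apply (comp_blinfun (p k)) g" g]
        Isom_norm[OF comp_blinfun_Isom[OF K p], of k g] by simp
    show "apply_bcontfun (blinfun_apply (comp_blinfun (p j)) g - g) x = 0 \<or>
        apply_bcontfun (blinfun_apply (comp_blinfun (p k)) g - g) x = 0" if "j \<noteq> k" for j k x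
      using disj[OF that, of x] by (auto simp: ap)
  qed
  then show "(\<lambda>k. blinfun_apply l (blinfun_apply (comp_blinfun (p k)) g)) \<longlonglongrightarrow> blinfun_apply l (blinfun_apply id_blinfun g)"
    by (simp add: blinfun.diff_right LIM_zero_iff)
next
  fix k
  obtain x where x: "e \<le> \<bar>f (p k x) - f x\<bar>"
    using f(3) by blast
  show "e \<le> norm (blinfun_apply (comp_blinfun (p k)) (Bcontfun f) - blinfun_apply id_blinfun (Bcontfun f))"
    using x norm_bounded[of "blinfun_apply (comp_blinfun (p k)) (Bcontfun f) - Bcontfun f" x]
    by (simp add: comp_blinfun_apply[OF K p(1)] apply_Bcontfun[OF K f(1)])
qed

section \<open>Extending maps from a closed set to the whole space\<close>

text \<open>Pasting along the closed sets \<open>B\<close> and \<open>- W\<close>, whose overlap is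
  \<open>B - W\<close>.\<close>

lemma continuous_on_extend_closed:
  assumes "closed B" "open W" "W \<subseteq> B" "continuous_on B f" "continuous_on UNIV g"
    and "\<And>x. x \<in> B - W \<Longrightarrow> f x = g x"
  shows "continuous_on UNIV (\<lambda>x. if x \<in> B then f x else g x)"
proof -
  have "continuous_on (B \<union> - W) (\<lambda>x. if x \<in> B then f x else g x)"
    using assms by (intro continuous_on_cases) (auto intro: continuous_on_subset)
  moreover have "B \<union> - W = UNIV"
    using assms by blast
  ultimately show ?thesis by simp
qed

text \<open>The map is a conjugate of \<open>F\<close> on the image of \<open>Q\<close> and the
  identity on the complement.\<close>

lemma bij_transfer_extend:
  assumes inj: "inj_on g Q" and hg: "\<And>y. y \<in> Q \<Longrightarrow> h (g y) = y" and F: "bij_betw F Q Q"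
  shows "bij (\<lambda>x. if x \<in> g ` Q then g (F (h x)) else x)"
proof -
  have "bij_betw h (g ` Q) Q"
    by (rule bij_betw_byWitness[of _ g]) (auto simp: hg)
  moreover have "bij_betw g Q (g ` Q)"
    using inj by (simp add: bij_betw_def)
  ultimately have "bij_betw (g \<circ> (F \<circ> h)) (g ` Q) (g ` Q)"
    using F by (meson bij_betw_trans)
  then have "bij_betw (\<lambda>x. if x \<in> g ` Q then g (F (h x)) else x) (g ` Q) (g ` Q)"
    by (rule bij_betw_cong[THEN iffD1, rotated]) simp
  moreover have "bij_betw (\<lambda>x. if x \<in> g ` Q then g (F (h x)) else x) (- g ` Q) (- g ` Q)"
    by (rule bij_betw_cong[THEN iffD1, OF _ bij_betw_id]) simp
  ultimately show ?thesis
    using bij_betw_combine by fastforce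
qed

section \<open>Shears of a cube\<close>

text \<open>For n > 0 and \<open>y\<close> in the cube, this is the distance to its boundary in the
  maximum norm. It describes the open cube and serves as a cutoff function.\<close>

definition cube_depth :: "nat \<Rightarrow> (nat \<Rightarrow> real) \<Rightarrow> real \<Rightarrow> (nat \<Rightarrow> real) \<Rightarrow> real" where
  "cube_depth n c r y = Min ((\<lambda>i. r - \<bar>y i - c i\<bar>) ` {..<n})"

definition cube :: "nat \<Rightarrow> (nat \<Rightarrow> real) \<Rightarrow> real \<Rightarrow> (nat \<Rightarrow> real) set" where
  "cube n c r = {y. (\<forall>i\<ge>n. y i = 0) \<and> (\<forall>i<n. \<bar>y i - c i\<bar> \<le> r)}"

lemma cube_depth_ge_iff: "n > 0 \<Longrightarrow> s \<le> cube_depth n c r y \<longleftrightarrow> (\<forall>i<n. \<bar>y i - c i\<bar> \<le> r - s)"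
  unfolding cube_depth_def by (subst Min_ge_iff) (auto simp: algebra_simps)

lemma cube_depth_pos_iff: "n > 0 \<Longrightarrow> 0 < cube_depth n c r y \<longleftrightarrow> (\<forall>i<n. \<bar>y i - c i\<bar> < r)"
  unfolding cube_depth_def by (subst Min_gr_iff) auto

lemma cube_depth_upper: "i < n \<Longrightarrow> cube_depth n c r y \<le> r - \<bar>y i - c i\<bar>"
  unfolding cube_depth_def by (rule Min_le) auto

lemma continuous_on_cube_depth:
  assumes "n > 0"
  shows "continuous_on UNIV (cube_depth n c r)"
proof -
  have "continuous_on UNIV (\<lambda>y :: nat \<Rightarrow> real. Min ((\<lambda>i. r - \<bar>y i - c i\<bar>) ` I))"
    if "finite I" "I \<noteq> {}" for I
    using that
    by (induction rule: finite_ne_induct) (auto intro!: continuous_intros)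
  from this[of "{..<n}"] show ?thesis
    using assms unfolding cube_depth_def by auto
qed

text \<open>Tychonoff: the cube is a product of intervals in the coordinates below \<open>n\<close>
  and {0} in the others.\<close>

lemma compact_cube: "compact (cube n c r)"
proof -
  define S where "S = (\<lambda>i. if i < n then cball (c i) r else {0 :: real})"
  have S: "t \<in> S i \<longleftrightarrow> (n \<le> i \<longrightarrow> t = 0) \<and> (i < n \<longrightarrow> \<bar>t - c i\<bar> \<le> r)" for t i
    by (simp add: S_def dist_real_def abs_minus_commute)
  have "compact (S i)" for i
    by (simp add: S_def)
  then have "compactin (product_topology (\<lambda>_. euclidean) UNIV) (PiE UNIV S)"
    unfolding compactin_PiE by simp
  then have "compact (PiE UNIV S)"
    unfolding euclidean_product_topology by simp
  also have "PiE UNIV S = cube n c r"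
    unfolding cube_def PiE_UNIV_domain Pi_def S by fast
  finally show ?thesis .
qed

lemma openin_Euclidean_space_contains_cube:
  assumes V: "openin (Euclidean_space n) V" and c: "c \<in> V"
  obtains r where "r > 0" "cube n c r \<subseteq> V"
proof -
  obtain S where S: "openin (powertop_real UNIV) S" "V = S \<inter> {x. \<forall>i\<ge>n. x i = 0}"
    using V unfolding Euclidean_space_def by (auto simp: openin_subtopology)
  have "c \<in> S"
    using c S(2) by blast
  with S(1) obtain X where X: "\<And>i. open (X i)" "c \<in> Pi\<^sub>E UNIV X" "Pi\<^sub>E UNIV X \<subseteq> S"
    unfolding openin_product_topology_alt topspace_euclidean open_openin[symmetric]
    by (meson UNIV_I)
  have "\<exists>e>0. cball (c i) e \<subseteq> X i" for i
    using X(1,2) open_contains_cball[of "X i"] by auto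
  then obtain e where e: "\<And>i. e i > 0" "\<And>i. cball (c i) (e i) \<subseteq> X i" by metis
  \<comment> \<open>Only coordinates below \<open>n\<close> constrain the radius, as all later ones
    vanish both in \<open>c\<close> and in the cube. The 1 keeps the set nonempty when n =
    0.\<close>
  define r where "r = Min (insert 1 (e ` {..<n}))"
  have r: "r \<le> e i" if "i < n" for i
    unfolding r_def using that by (intro Min_le) auto
  show ?thesis
  proof
    show "r > 0"
      unfolding r_def using e(1) by (subst Min_gr_iff) auto
    show "cube n c r \<subseteq> V"
    proof
      fix y assume y: "y \<in> cube n c r"
      have "y i \<in> X i" for i
      proof (cases "i < n")
        case True
        then have "\<bar>y i - c i\<bar> \<le> r"
          using y by (simp add: cube_def)
        with r[OF True] e(2)[of i] show ?thesis
          by (auto simp: subset_iff dist_real_def abs_minus_commute)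
      next
        case False
        then have "y i = c i"
          using y c S(2) by (simp add: cube_def)
        then show ?thesis
          using X(2) by auto
      qed
      then show "y \<in> V"
        using X(3) y S(2) by (auto simp: cube_def)
    qed
  qed
qed

text \<open>The slabs \<open>slab_depth > 0\<close> are disjoint for different \<open>k\<close> and shrink towards the hyperplane
  \<open>y 0 = c 0\<close>, but they keep their extent in direction \<open>1\<close>, in which the shear moves points.
  Hence a single function detects the displacement uniformly in \<open>k\<close>.  This needs \<open>n \<ge> 2\<close>.\<close>
definition slab_depth :: "(nat \<Rightarrow> real) \<Rightarrow> real \<Rightarrow> nat \<Rightarrow> (nat \<Rightarrow> real) \<Rightarrow> real" where
  "slab_depth c r k y = r - 8 * 2 ^ k * \<bar>y 0 - (c 0 + r / 2 ^ Suc k)\<bar>"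

text \<open>Truncation at 0 confines the shear to the slab and the open cube. The factor 1/2 makes
  the height a contraction in coordinate 1, which gives injectivity of the shear.\<close>

definition shear_height :: "nat \<Rightarrow> (nat \<Rightarrow> real) \<Rightarrow> real \<Rightarrow> nat \<Rightarrow> (nat \<Rightarrow> real) \<Rightarrow> real" where
  "shear_height n c r k y = max 0 (min (slab_depth c r k y) (cube_depth n c r y)) / 2"

definition shear :: "nat \<Rightarrow> (nat \<Rightarrow> real) \<Rightarrow> real \<Rightarrow> nat \<Rightarrow> (nat \<Rightarrow> real) \<Rightarrow> nat \<Rightarrow> real" where
  "shear n c r k y = y(1 := y 1 + shear_height n c r k y)"

text \<open>With E i = r / 2^i, the offset of \<open>y 0\<close> from \<open>c 0\<close> lies
  strictly between 3/8 and 5/8 of E i in slab i. Since E k \<le> E j / 2, the ranges for j < k do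
  not meet.\<close>

lemma slab_depth_disjoint:
  assumes "j < k" "0 < slab_depth c r j y" "0 < slab_depth c r k y"
  shows False
proof -
  define E where "E = (\<lambda>k :: nat. r / 2 ^ k)"
  have pos: "\<bar>y 0 - (c 0 + E i / 2)\<bar> < E i / 8" if "0 < slab_depth c r i y" for i
  proof -
    have "\<bar>y 0 - (c 0 + E i / 2)\<bar> * (8 * 2 ^ i) < r"
      using that by (simp add: slab_depth_def E_def mult.commute)
    then have "\<bar>y 0 - (c 0 + E i / 2)\<bar> < r / (8 * 2 ^ i)"
      by (subst pos_less_divide_eq) auto
    then show ?thesis
      by (simp add: E_def mult.commute)
  qed
  have "r > 0"
    using assms(2) order.strict_trans2[of 0 "slab_depth c r j y" r] by (simp add: slab_depth_def)
  then have "E k \<le> E (Suc j)"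
    unfolding E_def using assms(1) by (intro divide_left_mono power_increasing) auto
  then have "E k \<le> E j / 2"
    by (simp add: E_def)
  then show False
    using pos[OF assms(2)] pos[OF assms(3)] by linarith
qed

lemma continuous_on_slab_depth: "continuous_on UNIV (slab_depth c r k)"
  unfolding slab_depth_def by (intro continuous_intros) auto

lemma continuous_on_shear_height: "n > 0 \<Longrightarrow> continuous_on UNIV (shear_height n c r k)"
  unfolding shear_height_def
  by (intro continuous_intros continuous_on_slab_depth continuous_on_cube_depth) auto

lemma continuous_on_upd: "continuous_on UNIV (\<lambda>t :: real. (y :: nat \<Rightarrow> real)(i := t))"
proof (rule continuous_on_coordinatewise_then_product)
  show "continuous_on UNIV (\<lambda>t. (y(i := t)) j)" for j
    by (cases "j = i") auto
qed

lemma continuous_on_shear: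
  assumes "n > 0"
  shows "continuous_on UNIV (shear n c r k)"
proof (rule continuous_on_coordinatewise_then_product)
  show "continuous_on UNIV (\<lambda>y. shear n c r k y i)" for i
    by (cases "i = 1")
      (auto simp: shear_def intro!: continuous_intros continuous_on_shear_height[OF assms])
qed

lemma shear_height_bounds:
  assumes "y \<in> cube n c r" "i < n"
  shows "0 \<le> shear_height n c r k y" "shear_height n c r k y \<le> (r - \<bar>y i - c i\<bar>) / 2"
proof -
  show "0 \<le> shear_height n c r k y"
    by (simp add: shear_height_def)
  have "0 \<le> r - \<bar>y i - c i\<bar>"
    using assms by (simp add: cube_def)
  then show "shear_height n c r k y \<le> (r - \<bar>y i - c i\<bar>) / 2"
    using cube_depth_upper[OF assms(2), of c r y] by (simp add: shear_height_def)
qed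

text \<open>The slab depth depends on coordinate 0 alone, so only the cube depth varies, at rate at
  most 1; clamping does not increase the rate and the division halves it.\<close>

lemma shear_height_lipschitz:
  assumes "n \<ge> 2" "\<And>i. i \<noteq> 1 \<Longrightarrow> y i = z i"
  shows "\<bar>shear_height n c r k y - shear_height n c r k z\<bar> \<le> \<bar>y 1 - z 1\<bar> / 2"
proof -
  have le: "cube_depth n c r y - \<bar>y 1 - z 1\<bar> \<le> cube_depth n c r z"
    if "\<And>i. i \<noteq> 1 \<Longrightarrow> y i = z i" for y z :: "nat \<Rightarrow> real"
  proof (subst cube_depth_ge_iff)
    show "\<forall>i<n. \<bar>z i - c i\<bar> \<le> r - (cube_depth n c r y - \<bar>y 1 - z 1\<bar>)"
    proof (intro allI impI)
      fix i assume "i < n"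
      then have "cube_depth n c r y \<le> r - \<bar>y i - c i\<bar>"
        by (rule cube_depth_upper)
      then show "\<bar>z i - c i\<bar> \<le> r - (cube_depth n c r y - \<bar>y 1 - z 1\<bar>)"
        using that[of i] by (cases "i = 1") auto
    qed
  qed (use assms(1) in auto)
  have "slab_depth c r k y = slab_depth c r k z"
    using assms(2)[of 0] by (simp add: slab_depth_def)
  moreover have "\<bar>cube_depth n c r y - cube_depth n c r z\<bar> \<le> \<bar>y 1 - z 1\<bar>"
    using le[of y z] le[of z y] assms(2) by (simp add: abs_minus_commute abs_le_iff)
  moreover have "\<bar>max 0 (min s a) - max 0 (min s b)\<bar> \<le> \<bar>a - b\<bar>" for s a b :: real
    by (auto simp: max_def min_def)
  ultimately have "\<bar>max 0 (min (slab_depth c r k y) (cube_depth n c r y))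
      - max 0 (min (slab_depth c r k z) (cube_depth n c r z))\<bar> \<le> \<bar>y 1 - z 1\<bar>"
    by (metis order_trans)
  then show ?thesis
    by (simp add: shear_height_def abs_divide flip: diff_divide_distrib)
qed

lemma shear_cube:
  assumes "n \<ge> 2"
  shows "bij_betw (shear n c r k) (cube n c r) (cube n c r)"
  unfolding bij_betw_def
proof
  note lip = shear_height_lipschitz[OF assms, of _ _ c r k]
  show "inj_on (shear n c r k) (cube n c r)"
  proof (rule inj_onI)
    fix y z assume eq: "shear n c r k y = shear n c r k z"
    have off: "y i = z i" if "i \<noteq> 1" for i
      using fun_cong[OF eq, of i] that by (simp add: shear_def)
    have "y 1 + shear_height n c r k y = z 1 + shear_height n c r k z"
      using fun_cong[OF eq, of 1] by (simp add: shear_def)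
    moreover have "\<bar>shear_height n c r k y - shear_height n c r k z\<bar> \<le> \<bar>y 1 - z 1\<bar> / 2"
      by (rule lip) (rule off)
    moreover from calculation have "shear_height n c r k y - shear_height n c r k z = z 1 - y 1"
      by linarith
    ultimately have "\<bar>y 1 - z 1\<bar> \<le> \<bar>y 1 - z 1\<bar> / 2"
      by (simp add: abs_minus_commute)
    then have "y 1 = z 1" by simp
    with off show "y = z" by (intro ext) metis
  qed
  show "shear n c r k ` cube n c r = cube n c r"
  proof
    show "shear n c r k ` cube n c r \<subseteq> cube n c r"
    proof clarify
      fix y assume y: "y \<in> cube n c r"
      have "\<bar>y 1 + shear_height n c r k y - c 1\<bar> \<le> r"
      proof -
        have "\<bar>y 1 - c 1\<bar> \<le> r"
          using y assms by (auto simp: cube_def)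
        moreover have "0 \<le> shear_height n c r k y" "shear_height n c r k y \<le> (r - \<bar>y 1 - c 1\<bar>) / 2"
          using shear_height_bounds[OF y, of 1 k] assms by simp_all
        ultimately show ?thesis
          using abs_triangle_ineq[of "y 1 - c 1" "shear_height n c r k y"]
          by (simp add: algebra_simps)
      qed
      then show "shear n c r k y \<in> cube n c r"
        using y assms by (auto simp: cube_def shear_def)
    qed
    show "cube n c r \<subseteq> shear n c r k ` cube n c r"
    proof
      fix z assume z: "z \<in> cube n c r"
      \<comment> \<open>The shear restricted to the line through \<open>z\<close> in direction 1. It
        fixes both ends of the segment in the cube, where the height is 0, so the intermediate value
        theorem yields a preimage of \<open>z\<close>.\<close>
      define q where "q = (\<lambda>t. t + shear_height n c r k (z(1 := t)))"
      have zt: "z(1 := t) \<in> cube n c r" if "\<bar>t - c 1\<bar> \<le> r" for t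
        using z that assms by (auto simp: cube_def)
      have r: "\<bar>z 1 - c 1\<bar> \<le> r"
        using z assms by (auto simp: cube_def)
      have ends: "q t = t" if "\<bar>t - c 1\<bar> = r" for t
        using shear_height_bounds[OF zt, of t 1 k] that assms by (simp add: q_def)
      have "continuous_on UNIV q"
        unfolding q_def using assms
        by (intro continuous_intros continuous_on_compose2[OF continuous_on_shear_height continuous_on_upd]) auto
      then have "continuous_on {c 1 - r..c 1 + r} q"
        by (rule continuous_on_subset) simp
      moreover have "q (c 1 - r) \<le> z 1" "z 1 \<le> q (c 1 + r)" "c 1 - r \<le> c 1 + r"
        using ends[of "c 1 - r"] ends[of "c 1 + r"] r by linarith+
      ultimately obtain t where t: "c 1 - r \<le> t" "t \<le> c 1 + r" "q t = z 1"
        using IVT'[of q "c 1 - r" "z 1" "c 1 + r"] by blast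
      have "z = shear n c r k (z(1 := t))"
        using t(3) by (auto simp: shear_def q_def)
      moreover have "z(1 := t) \<in> cube n c r"
        using t by (intro zt) auto
      ultimately show "z \<in> shear n c r k ` cube n c r" by blast
    qed
  qed
qed

lemma shear_moves:
  assumes "shear n c r k y \<noteq> y"
  shows "0 < slab_depth c r k y" "0 < cube_depth n c r y"
proof -
  have "shear_height n c r k y \<noteq> 0"
    using assms by (auto simp: shear_def)
  then show "0 < slab_depth c r k y" "0 < cube_depth n c r y"
    by (auto simp: shear_height_def max_def min_def split: if_splits)
qed

text \<open>The second factor of \<open>F\<close> measures motion in direction 1; the depth factor
  makes \<open>F\<close> vanish on the boundary of the cube, so that it can be extended by 0. The
  bound does not depend on \<open>k\<close>.\<close>

lemma shear_displacement:
  assumes n: "n \<ge> 2" and r: "r > 0" and c: "\<And>i. i \<ge> n \<Longrightarrow> c i = 0"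
  defines "F \<equiv> \<lambda>y. max 0 (cube_depth n c r y) * (y 1 - c 1)"
  shows "\<exists>y\<in>cube n c r. r\<^sup>2 / 8 \<le> \<bar>F (shear n c r k y) - F y\<bar>"
proof -
  \<comment> \<open>The centre of the cube moved onto the middle hyperplane of slab
    \<open>k\<close>: slab depth \<open>r\<close>, cube depth at least \<open>r / 2\<close>, and F y
    = 0.\<close>
  define y where "y = c(0 := c 0 + r / 2 ^ Suc k)"
  define s where "s = shear_height n c r k y"
  have "r / 2 ^ Suc k \<le> r / 2 ^ 1"
    using r by (intro divide_left_mono power_increasing) auto
  then have le: "r / 2 ^ Suc k \<le> r / 2" "0 \<le> r / 2 ^ Suc k"
    using r by simp_all
  have y: "y \<in> cube n c r"
    using c r n le by (auto simp: y_def cube_def)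
  have depth: "r / 2 \<le> cube_depth n c r y"
    using n r le by (subst cube_depth_ge_iff) (auto simp: y_def)
  have "slab_depth c r k y = r"
    by (simp add: slab_depth_def y_def)
  then have s: "r / 4 \<le> s" "s \<le> r / 2"
    using depth r by (auto simp: s_def shear_height_def)
  have shear: "shear n c r k y = y(1 := c 1 + s)"
    by (simp add: shear_def s_def) (simp add: y_def)
  have "r / 2 \<le> cube_depth n c r (shear n c r k y)"
    unfolding shear using n r le s by (subst cube_depth_ge_iff) (auto simp: y_def)
  then have "(r / 2) * (r / 4) \<le> max 0 (cube_depth n c r (shear n c r k y)) * s"
    using s r by (intro mult_mono) auto
  moreover have "F y = 0"
    by (simp add: F_def y_def)
  moreover have "F (shear n c r k y) = max 0 (cube_depth n c r (shear n c r k y)) * s"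
    by (simp add: F_def) (simp add: shear)
  ultimately have "r\<^sup>2 / 8 \<le> \<bar>F (shear n c r k y) - F y\<bar>"
    by (simp add: power2_eq_square)
  then show ?thesis
    using y by blast
qed

section \<open>Transport from the cube to the region\<close>

lemma region_homeomorphism:
  assumes "region n U"
  obtains V h g where "open U" "U \<noteq> {}" "openin (Euclidean_space n) V" "homeomorphism U V h g"
proof -
  obtain V where U: "open U" "U \<noteq> {}" and V: "openin (Euclidean_space n) V"
    and UV: "top_of_set U homeomorphic_space subtopology (Euclidean_space n) V"
    using assms by (auto simp: region_def)
  have "V \<subseteq> {x. \<forall>i\<ge>n. x i = 0}"
    using openin_subset[OF V] by (simp add: topspace_Euclidean_space)
  then have "subtopology (Euclidean_space n) V = top_of_set V"
    by (simp add: Euclidean_space_def euclidean_product_topology subtopology_subtopology inf.absorb2)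
  with UV obtain h g where hg: "homeomorphic_maps (top_of_set U) (top_of_set V) h g"
    by (auto simp: homeomorphic_space_def)
  then have "homeomorphism U V h g"
    unfolding homeomorphic_maps_def homeomorphism_def
    by (auto simp: continuous_map_in_subtopology image_iff Pi_iff) metis+
  with U V show ?thesis by (rule that)
qed

lemma not_light_space_region:
  assumes K: "compact (UNIV :: 'k::t2_space set)" and n: "n \<ge> 2" and U: "region n (U :: 'k set)"
  shows "\<not> light_space TYPE('k \<Rightarrow>\<^sub>C real)"
proof -
  obtain V h g where U: "open U" "U \<noteq> {}" and V: "openin (Euclidean_space n) V"
    and hom: "homeomorphism U V h g"
    by (rule region_homeomorphism[OF U])
  have hg: "continuous_on U h" "continuous_on V g" "\<And>x. x \<in> U \<Longrightarrow> g (h x) = x"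
    "\<And>y. y \<in> V \<Longrightarrow> h (g y) = y" "h ` U = V" "g ` V = U"
    using hom by (auto simp: homeomorphism_def)
  obtain c where c: "c \<in> V"
    using U(2) hg(5) by blast
  obtain r where r: "r > 0" "cube n c r \<subseteq> V"
    by (rule openin_Euclidean_space_contains_cube[OF V c])
  have VE: "V \<subseteq> {x. \<forall>i\<ge>n. x i = 0}"
    using openin_subset[OF V] by (simp add: topspace_Euclidean_space)
  let ?Q = "cube n c r"
  \<comment> \<open>\<open>W\<close> is the open cube. Its image is open in the whole space because
    \<open>U\<close> is; on the rest of the cube the shears are the identity and \<open>F\<close> is
    0, so the extensions below are continuous.\<close>
  define W where "W = V \<inter> {y. 0 < cube_depth n c r y}"
  have WQ: "W \<subseteq> ?Q"
    using VE n by (auto simp: W_def cube_def cube_depth_pos_iff intro: less_imp_le)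
  have gQ: "compact (g ` ?Q)"
    by (rule compact_continuous_image[OF continuous_on_subset[OF hg(2) r(2)] compact_cube])
  then have closed: "closed (g ` ?Q)"
    by (rule compact_imp_closed)
  have "open {y. 0 < cube_depth n c r y}"
    using n by (intro open_Collect_less continuous_on_cube_depth) auto
  then have "openin (top_of_set V) W"
    unfolding W_def by (rule openin_open_Int)
  then have "openin (top_of_set U) (g ` W)"
    by (rule homeomorphism_imp_open_map[OF homeomorphism_symD[OF hom]])
  then have gW: "open (g ` W)"
    using U(1) openin_open_trans by blast
  have gWQ: "g ` W \<subseteq> g ` ?Q"
    using WQ by blast
  have hQ: "continuous_on (g ` ?Q) h"
    using hg(1,6) r(2) by (metis continuous_on_subset image_mono)
  have hgQ: "h (g y) = y" if "y \<in> ?Q" for y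
    using that hg(4) r(2) by blast
  have off_W: "cube_depth n c r (h x) \<le> 0" "g (h x) = x" "h x \<in> ?Q" if "x \<in> g ` ?Q - g ` W" for x
    using that hgQ r(2) by (auto simp: W_def not_less)
  define p where "p = (\<lambda>k x. if x \<in> g ` ?Q then g (shear n c r k (h x)) else x)"
  define F where "F = (\<lambda>y. max 0 (cube_depth n c r y) * (y 1 - c 1))"
  define f where "f = (\<lambda>x. if x \<in> g ` ?Q then F (h x) else 0)"
  have shear_Q: "shear n c r k y \<in> ?Q" if "y \<in> ?Q" for k y
    using shear_cube[OF n, of c r k] that by (auto simp: bij_betw_def)
  show ?thesis
  proof (rule not_light_space_disjoint_moves[OF K])
    show "continuous_on UNIV (p k)" for k
      unfolding p_def
    proof (rule continuous_on_extend_closed[OF closed gW gWQ])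
      have sh: "continuous_on (g ` ?Q) (\<lambda>x. shear n c r k (h x))"
        using n by (intro continuous_on_compose2[OF continuous_on_shear hQ]) auto
      show "continuous_on (g ` ?Q) (\<lambda>x. g (shear n c r k (h x)))"
        by (rule continuous_on_compose2[OF hg(2) sh]) (use shear_Q hgQ r(2) in force)
      show "g (shear n c r k (h x)) = x" if "x \<in> g ` ?Q - g ` W" for x
        using shear_moves(2)[of n c r k "h x"] off_W[OF that] by fastforce
    qed simp
    show "bij (p k)" for k
      unfolding p_def
      by (rule bij_transfer_extend[OF _ hgQ shear_cube[OF n]]) (use hgQ in \<open>auto intro: inj_on_inverseI\<close>)
    show "p j x = x \<or> p k x = x" if "j \<noteq> k" for j k x
    proof (rule ccontr)
      assume neg: "\<not> ?thesis"
      then have x: "x \<in> g ` ?Q"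
        by (auto simp: p_def split: if_splits)
      then have "g (h x) = x"
        using hgQ by auto
      then have "shear n c r j (h x) \<noteq> h x" "shear n c r k (h x) \<noteq> h x"
        using neg x by (auto simp: p_def)
      then show False
        using shear_moves(1) slab_depth_disjoint \<open>j \<noteq> k\<close> by (metis linorder_neqE_nat)
    qed
    show "continuous_on UNIV f"
      unfolding f_def
    proof (rule continuous_on_extend_closed[OF closed gW gWQ])
      have "continuous_on UNIV F"
        unfolding F_def using n by (intro continuous_intros continuous_on_cube_depth) auto
      then show "continuous_on (g ` ?Q) (\<lambda>x. F (h x))"
        by (rule continuous_on_compose2[OF _ hQ]) simp
      show "F (h x) = 0" if "x \<in> g ` ?Q - g ` W" for x
        using off_W(1)[OF that] by (simp add: F_def)
    qed simp
    show "r\<^sup>2 / 8 > 0"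
      using r(1) by simp
    show "\<exists>x. r\<^sup>2 / 8 \<le> \<bar>f (p k x) - f x\<bar>" for k
    proof -
      have "c i = 0" if "i \<ge> n" for i
        using VE c that by blast
      then obtain y where y: "y \<in> ?Q" "r\<^sup>2 / 8 \<le> \<bar>F (shear n c r k y) - F y\<bar>"
        using shear_displacement[OF n r(1), of c k] unfolding F_def by blast
      then have "f (p k (g y)) = F (shear n c r k y)" "f (g y) = F y"
        using hgQ shear_Q by (simp_all add: p_def f_def)
      with y(2) show ?thesis by metis
    qed
  qed
qed

theorem theorem5p9:
  assumes "compact (UNIV :: 'k::t2_space set)"
    and "connected (UNIV :: 'k set)"
    and "infinite (UNIV :: 'k set)"
  shows "((\<exists>\<S> :: real set set. finite \<S> \<and> (\<forall>s\<in>\<S>. \<exists>a b. s = closed_segment a b) \<and>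
            (UNIV :: 'k set) homeomorphic \<Union>\<S>)
          \<longrightarrow> light_space TYPE('k \<Rightarrow>\<^sub>C real)) \<and>
         ((\<exists>n\<ge>2. \<exists>U :: 'k set. region n U) \<longrightarrow> \<not> light_space TYPE('k \<Rightarrow>\<^sub>C real))"
  using light_space_segments[OF assms(1,2)] not_light_space_region[OF assms(1)] by blast

end
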